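(* Let $X$ be a Polish space and $\mathcal K$ a separable Rosenthal compact on $X$ which is a pre-metric compactum of degree exactly two. Then for every dense sequence $\mathbf f=(f_n)_n$ in $\mathcal K$ the set $\mathcal L_{\mathbf f}$ is Borel.
   Context: A Rosenthal compact on a Polish space $X$ is a set of real-valued Baire-1 functions on $X$ compact in the pointwise topology; separable means having a countable dense subset; $\mathbf f$ is dense in $\mathcal K$ if $\{f_n\}$ is dense in $\mathcal K$. $\mathcal K$ is a pre-metric compactum of degree exactly two if there exist a countable set $D\subseteq X$ and a countable set $\mathcal D\subseteq\mathcal K$ such that at most two functions in $\mathcal K$ coincide on $D$, and for every $f\in\mathcal K\setminus\mathcal D$ there exists $g\in\mathcal K$ with $g\ne f$ and $g|_D=f|_D$. $[\mathbb N]$ is the set of infinite subsets of $\mathbb N$ (Polish subspace of $2^{\mathbb N}$), and $\mathcal L_{\mathbf f}=\{L\in[\mathbb N]:(f_n)_{n\in L}\text{ converges pointwise on }X\}$. *)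

theory Defs
  imports "HOL-Analysis.Analysis" "HOL-Library.Infinite_Set"
begin

text \<open>The Polish space X is modelled as a type of class polish_space (X = UNIV).
  Functions X -> real carry the product (= pointwise convergence) topology
  from Function_Topology.\<close>

definition baire1 :: "('a::topological_space \<Rightarrow> real) \<Rightarrow> bool" where
  "baire1 f \<longleftrightarrow> (\<exists>g :: nat \<Rightarrow> 'a \<Rightarrow> real.
      (\<forall>n. continuous_on UNIV (g n)) \<and> (\<forall>x. (\<lambda>n. g n x) \<longlonglongrightarrow> f x))"

definition rosenthal_compact :: "('a::topological_space \<Rightarrow> real) set \<Rightarrow> bool" where
  "rosenthal_compact K \<longleftrightarrow> (\<forall>f\<in>K. baire1 f) \<and> compact K"

definition separable_set :: "('a::topological_space \<Rightarrow> real) set \<Rightarrow> bool" where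
  "separable_set K \<longleftrightarrow> (\<exists>C. C \<subseteq> K \<and> countable C \<and> K \<subseteq> closure C)"

definition pre_metric_degree_two :: "('a \<Rightarrow> real) set \<Rightarrow> bool" where
  "pre_metric_degree_two K \<longleftrightarrow>
     (\<exists>(D :: 'a set) (DD :: ('a \<Rightarrow> real) set).
        countable D \<and> countable DD \<and> DD \<subseteq> K \<and>
        (\<forall>f\<in>K. finite {g\<in>K. \<forall>x\<in>D. g x = f x} \<and> card {g\<in>K. \<forall>x\<in>D. g x = f x} \<le> 2) \<and>
        (\<forall>f\<in>K - DD. \<exists>g\<in>K. g \<noteq> f \<and> (\<forall>x\<in>D. g x = f x)))"

text \<open>Subsets of nat are identified with their characteristic functions in
  the Cantor space nat => bool (product of discrete bool).\<close>

definition inf_subsets :: "(nat \<Rightarrow> bool) set" where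
  "inf_subsets = {L. infinite (Collect L)}"

definition conv_set :: "(nat \<Rightarrow> 'a \<Rightarrow> real) \<Rightarrow> (nat \<Rightarrow> bool) set" where
  "conv_set f = {L \<in> inf_subsets.
      \<forall>x. convergent (\<lambda>k. f (enumerate (Collect L) k) x)}"

end

theory Submission
  imports Defs
begin

text \<open>Both \<open>conv_set f\<close>, up to countably many Borel pieces, and the set of those \<open>L\<close> along which \<open>f\<close>
  converges on \<open>D\<close> but not everywhere are projections of Borel sets along \<open>X\<close>, so Lusin separation
  applies. For the first: if the limit \<open>h\<close> along \<open>L\<close> lies outside the countable set of exceptions,
  some \<open>g\<close> in \<open>K\<close> agrees with \<open>h\<close> on \<open>D\<close> and differs from it at some \<open>x\<close>. Conversely, suppose that
  the sequence along \<open>L\<close> converges on \<open>D\<close> and at \<open>x\<close>, and some \<open>g\<close> in \<open>K\<close> extends the limit on \<open>D\<close>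
  with a different value at \<open>x\<close>. Since the fibres over \<open>D\<close> have at most two elements, one of
  which is \<open>g\<close>, there is only one cluster point, and by compactness the sequence converges everywhere.
  Finally, convergence to an exceptional \<open>d\<close> is a Borel condition on \<open>L\<close>, because inside \<open>K\<close> the
  function \<open>d\<close> is determined by its values on \<open>D\<close> and finitely many further points.\<close>

subsection \<open>Souslin sets and Lusin separation\<close>

text \<open>In a complete separable metric space these are the analytic sets. The parameter space
  \<open>nat => real\<close> is complete, so the shrinking argument below can be run in the product
  itself.\<close>

definition souslin :: "'a::topological_space set \<Rightarrow> bool" where
  "souslin S \<longleftrightarrow> (\<exists>C :: ('a \<times> (nat \<Rightarrow> real)) set. closed C \<and> S = fst ` C)"

lemma souslin_closed: "closed S \<Longrightarrow> souslin S"
  unfolding souslin_def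
  by (rule exI[of _ "S \<times> UNIV"]) (auto intro: closed_Times)

lemma closed_vimage_UNIV: "closed C \<Longrightarrow> continuous_on UNIV f \<Longrightarrow> closed {x. f x \<in> C}"
  using closed_vimage[of C f] by (simp add: vimage_def)

text \<open>Coordinate 0 of the parameter names a member of the union, and the shifted tail is a
  parameter for that member.\<close>

lemma souslin_UN:
  fixes S :: "nat \<Rightarrow> 'a::topological_space set"
  assumes "\<And>n. souslin (S n)"
  shows "souslin (\<Union>n. S n)"
proof -
  obtain C :: "nat \<Rightarrow> ('a \<times> (nat \<Rightarrow> real)) set" where cl: "\<And>n. closed (C n)" and S: "\<And>n. S n = fst ` C n"
    using assms unfolding souslin_def by metis
  \<comment> \<open>\<open>E n\<close> encodes the implication from \<open>snd p 0 = real n\<close>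
    to membership in \<open>C n\<close>. A natural number other than \<open>n\<close> has distance
    at least 1 from \<open>n\<close>, so the condition can be stated as a closed one.\<close>
  define E :: "nat \<Rightarrow> ('a \<times> (nat \<Rightarrow> real)) set" where
    "E n = {p. \<bar>snd p 0 - real n\<bar> \<ge> 1} \<union> {p. (fst p, \<lambda>k. snd p (Suc k)) \<in> C n}" for n
  define B where "B = {p :: 'a \<times> (nat \<Rightarrow> real). snd p 0 \<in> \<nat>} \<inter> (\<Inter>n. E n)"
  have coord: "continuous_on UNIV (\<lambda>p :: 'a \<times> (nat \<Rightarrow> real). snd p k)" for k
    by (rule continuous_on_product_then_coordinatewise[OF continuous_on_snd[OF continuous_on_id]])
  have "closed (E n)" for n
  proof -
    have "continuous_on UNIV (\<lambda>p :: 'a \<times> (nat \<Rightarrow> real). \<lambda>k. snd p (Suc k))"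
      by (rule continuous_on_coordinatewise_then_product) (rule coord)
    then have "continuous_on UNIV (\<lambda>p :: 'a \<times> (nat \<Rightarrow> real). (fst p, \<lambda>k. snd p (Suc k)))"
      by (rule continuous_on_Pair[OF continuous_on_fst[OF continuous_on_id]])
    from closed_vimage_UNIV[OF cl this]
    have "closed {p. (fst p, \<lambda>k. snd p (Suc k)) \<in> C n}" .
    moreover have "continuous_on UNIV (\<lambda>p :: 'a \<times> (nat \<Rightarrow> real). \<bar>snd p 0 - real n\<bar>)"
      using coord[of 0] by (intro continuous_on_rabs continuous_on_diff continuous_on_const)
    then have "closed {p :: 'a \<times> (nat \<Rightarrow> real). 1 \<le> \<bar>snd p 0 - real n\<bar>}"
      by (rule closed_Collect_le[OF continuous_on_const])
    ultimately show ?thesis unfolding E_def by (simp add: closed_Un)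
  qed
  moreover have "closed {p :: 'a \<times> (nat \<Rightarrow> real). snd p 0 \<in> \<nat>}"
    by (rule closed_vimage_UNIV[OF closed_Nats coord])
  ultimately have "closed B"
    unfolding B_def by blast
  moreover have "(\<Union>n. S n) = fst ` B"
  proof safe
    fix x n assume "x \<in> S n"
    then obtain \<phi> where \<phi>: "(x, \<phi>) \<in> C n" using S by auto
    define \<psi> where "\<psi> = case_nat (real n) \<phi>"
    have "(x, \<psi>) \<in> E m" for m
      using \<phi> by (cases "m = n") (auto simp: E_def \<psi>_def)
    then have "(x, \<psi>) \<in> B" by (auto simp: B_def \<psi>_def)
    then show "x \<in> fst ` B" by force
  next
    fix x \<phi> assume B: "(x, \<phi>) \<in> B"
    then obtain n where "\<phi> 0 = real n" by (auto simp: B_def Nats_def)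
    moreover have "(x, \<phi>) \<in> E n" using B by (auto simp: B_def)
    ultimately have "(x, \<lambda>k. \<phi> (Suc k)) \<in> C n" by (auto simp: E_def)
    then have "x \<in> S n" unfolding S by force
    then show "fst (x, \<phi>) \<in> (\<Union>n. S n)" by auto
  qed
  ultimately show ?thesis unfolding souslin_def by blast
qed

text \<open>Membership in every \<open>S n\<close> comes with one parameter for each
  \<open>n\<close>; \<open>prod_encode\<close> packs this sequence of parameters into a single
  one.\<close>

lemma souslin_INT:
  fixes S :: "nat \<Rightarrow> 'a::topological_space set"
  assumes "\<And>n. souslin (S n)"
  shows "souslin (\<Inter>n. S n)"
proof -
  obtain C :: "nat \<Rightarrow> ('a \<times> (nat \<Rightarrow> real)) set" where cl: "\<And>n. closed (C n)" and S: "\<And>n. S n = fst ` C n"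
    using assms unfolding souslin_def by metis
  define B where "B = (\<Inter>n. {p. (fst p, \<lambda>k. snd p (prod_encode (n, k))) \<in> C n})"
  have coord: "continuous_on UNIV (\<lambda>p :: 'a \<times> (nat \<Rightarrow> real). snd p k)" for k
    by (rule continuous_on_product_then_coordinatewise[OF continuous_on_snd[OF continuous_on_id]])
  have "closed {p. (fst p, \<lambda>k. snd p (prod_encode (n, k))) \<in> C n}" for n
  proof -
    have "continuous_on UNIV (\<lambda>p :: 'a \<times> (nat \<Rightarrow> real). \<lambda>k. snd p (prod_encode (n, k)))"
      by (rule continuous_on_coordinatewise_then_product) (rule coord)
    then have "continuous_on UNIV (\<lambda>p :: 'a \<times> (nat \<Rightarrow> real). (fst p, \<lambda>k. snd p (prod_encode (n, k))))"
      by (rule continuous_on_Pair[OF continuous_on_fst[OF continuous_on_id]])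
    from closed_vimage_UNIV[OF cl this] show ?thesis .
  qed
  then have "closed B" unfolding B_def by blast
  moreover have "(\<Inter>n. S n) = fst ` B"
  proof safe
    fix x assume "x \<in> (\<Inter>n. S n)"
    then have "\<forall>n. \<exists>\<phi>. (x, \<phi>) \<in> C n" unfolding S by force
    then obtain \<Phi> where \<Phi>: "\<And>n. (x, \<Phi> n) \<in> C n" by metis
    have "(x, \<lambda>i. case prod_decode i of (n, k) \<Rightarrow> \<Phi> n k) \<in> B"
      using \<Phi> by (auto simp: B_def)
    then show "x \<in> fst ` B" by force
  next
    fix x \<phi> n assume B: "(x, \<phi>) \<in> B"
    then have "(x, \<lambda>k. \<phi> (prod_encode (n, k))) \<in> C n" by (auto simp: B_def)
    then show "fst (x, \<phi>) \<in> S n" unfolding S by force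
  qed
  ultimately show ?thesis unfolding souslin_def by blast
qed

lemma souslin_open:
  fixes S :: "'a::metric_space set"
  assumes "open S"
  shows "souslin S"
\<comment> \<open>\<open>infdist\<close> to the empty set is 0, so the distance to the complement
  describes \<open>S\<close> only when the complement is nonempty.\<close>
proof (cases "S = UNIV")
  case True
  then show ?thesis by (simp add: souslin_closed)
next
  case False
  have "S = (\<Union>n. {x. inverse (real (Suc n)) \<le> infdist x (- S)})"
  proof safe
    fix x assume "x \<in> S"
    then have "infdist x (- S) > 0"
      using assms False by (intro infdist_pos_not_in_closed) auto
    then obtain n where "inverse (real (Suc n)) < infdist x (- S)"
      using reals_Archimedean by blast
    then show "x \<in> (\<Union>n. {x. inverse (real (Suc n)) \<le> infdist x (- S)})"
      by (auto intro: less_imp_le)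
  next
    fix x n assume *: "inverse (real (Suc n)) \<le> infdist x (- S)"
    show "x \<in> S"
    proof (rule ccontr)
      assume "x \<notin> S"
      then have "infdist x (- S) = 0" by simp
      moreover have "inverse (real (Suc n)) > 0" by simp
      ultimately show False using * by linarith
    qed
  qed
  moreover have "souslin (\<Union>n. {x. inverse (real (Suc n)) \<le> infdist x (- S)})"
    by (intro souslin_UN souslin_closed closed_Collect_le continuous_intros)
  ultimately show ?thesis by simp
qed

text \<open>Complements of Souslin sets need not be Souslin, so the induction carries the complement
  along; closure under countable unions and intersections then serves the set and its
  complement.\<close>

lemma souslin_borel:
  fixes S :: "'a::metric_space set"
  assumes "S \<in> sets borel"
  shows "souslin S"
proof -
  have "S \<in> sigma_sets UNIV {S. open S}"
    using assms by (simp add: borel_def)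
  then have "souslin S \<and> souslin (- S)"
  proof induction
    case (Basic a)
    then show ?case by (auto intro: souslin_open souslin_closed)
  next
    case Empty
    show ?case by (simp add: souslin_closed)
  next
    case (Compl a)
    then show ?case by (simp add: Compl_eq_Diff_UNIV[symmetric])
  next
    case (Union a)
    then show ?case by (auto intro: souslin_UN souslin_INT)
  qed
  then show ?thesis ..
qed

section \<open>Separation by Borel sets\<close>

definition borel_separated :: "'a::topological_space set \<Rightarrow> 'a set \<Rightarrow> bool" where
  "borel_separated A B \<longleftrightarrow> (\<exists>S \<in> sets borel. A \<subseteq> S \<and> S \<inter> B = {})"

lemma borel_separated_UN:
  fixes A B :: "nat \<Rightarrow> 'a::topological_space set"
  assumes "\<And>n m. borel_separated (A n) (B m)"
  shows "borel_separated (\<Union>n. A n) (\<Union>m. B m)"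
proof -
  obtain S where S: "\<And>n m. S n m \<in> sets borel" "\<And>n m. A n \<subseteq> S n m" "\<And>n m. S n m \<inter> B m = {}"
    using assms unfolding borel_separated_def by metis
  have "(\<Union>n. A n) \<subseteq> (\<Union>n. \<Inter>m. S n m)"
    by (intro UN_mono INT_greatest S(2)) simp
  moreover have "(\<Union>n. \<Inter>m. S n m) \<inter> (\<Union>m. B m) = {}"
  proof -
    have False if "x \<in> (\<Inter>m. S n m)" "x \<in> B m" for x n m
    proof -
      have "x \<in> S n m \<inter> B m" using that by simp
      then show False by (simp add: S(3))
    qed
    then show ?thesis by blast
  qed
  moreover have "(\<Union>n. \<Inter>m. S n m) \<in> sets borel" using S(1) by auto
  ultimately show ?thesis unfolding borel_separated_def by (intro bexI conjI)
qed

lemma borel_separated_empty: "borel_separated {} B" "borel_separated A {}"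
  unfolding borel_separated_def by (auto intro: bexI[of _ "{}"] bexI[of _ UNIV])

lemma UNIV_eq_UN_cball:
  assumes "e > 0"
  shows "\<exists>d :: nat \<Rightarrow> 'a::{metric_space, second_countable_topology}. (\<Union>n. cball (d n) e) = UNIV"
proof -
  obtain D :: "'a set" where D: "countable D" "\<And>X. open X \<Longrightarrow> X \<noteq> {} \<Longrightarrow> \<exists>d\<in>D. d \<in> X"
    by (erule countable_dense_setE)
  have "\<exists>n. x \<in> cball (from_nat_into D n) e" for x
  proof -
    obtain d where "d \<in> D" "d \<in> ball x e"
      using D(2)[of "ball x e"] assms by auto
    moreover then obtain n where "d = from_nat_into D n"
      by (metis D(1) from_nat_into_surj)
    ultimately show ?thesis by (auto simp: dist_commute intro!: less_imp_le)
  qed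
  then show ?thesis by blast
qed

text \<open>Countably many balls of radius \<open>e\<close> cover each space. If every pair of
  pieces were separated, \<open>borel_separated_UN\<close> would separate the whole images.\<close>

lemma not_borel_separated_small:
  fixes P :: "'a::{metric_space, second_countable_topology} set"
    and Q :: "'b::{metric_space, second_countable_topology} set"
    and \<phi> :: "'a \<Rightarrow> 'c::topological_space" and \<psi> :: "'b \<Rightarrow> 'c"
  assumes "\<not> borel_separated (\<phi> ` P) (\<psi> ` Q)" and "e > 0"
  shows "\<exists>a b. \<not> borel_separated (\<phi> ` (P \<inter> cball a e)) (\<psi> ` (Q \<inter> cball b e))"
proof (rule ccontr)
  assume sep: "\<not> ?thesis"
  obtain d :: "nat \<Rightarrow> 'a" where d: "(\<Union>n. cball (d n) e) = UNIV"
    using UNIV_eq_UN_cball[OF assms(2)] by blast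
  obtain d' :: "nat \<Rightarrow> 'b" where d': "(\<Union>n. cball (d' n) e) = UNIV"
    using UNIV_eq_UN_cball[OF assms(2)] by blast
  have "borel_separated (\<Union>n. \<phi> ` (P \<inter> cball (d n) e)) (\<Union>n. \<psi> ` (Q \<inter> cball (d' n) e))"
    using sep by (intro borel_separated_UN) blast
  moreover have "(\<Union>n. \<phi> ` (P \<inter> cball (d n) e)) = \<phi> ` P" using d by blast
  moreover have "(\<Union>n. \<psi> ` (Q \<inter> cball (d' n) e)) = \<psi> ` Q" using d' by blast
  ultimately show False using assms(1) by simp
qed

text \<open>Cantor's intersection theorem: the set at index \<open>Suc n\<close> has diameter at
  most 2/(n+1).\<close>

lemma closed_nest_halving:
  fixes P :: "nat \<Rightarrow> 'a::complete_space set"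
  assumes "\<And>n. closed (P n)" "\<And>n. P n \<noteq> {}"
    and nest: "\<And>n. \<exists>a. P (Suc n) = P n \<inter> cball a (inverse (real (Suc n)))"
  obtains a where "\<And>n. a \<in> P n" "\<And>e. e > 0 \<Longrightarrow> \<exists>n. P n \<subseteq> ball a e"
proof -
  have small: "\<exists>n. \<forall>x\<in>P n. \<forall>y\<in>P n. dist x y < e" if "e > 0" for e
  proof -
    obtain n where n: "inverse (real (Suc n)) < e / 2"
      using \<open>e > 0\<close> reals_Archimedean[of "e / 2"] by auto
    obtain a where a: "P (Suc n) = P n \<inter> cball a (inverse (real (Suc n)))"
      using nest by blast
    have "dist x y < e" if "x \<in> P (Suc n)" "y \<in> P (Suc n)" for x y
      using that n dist_triangle3[of x y a] unfolding a by auto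
    then show ?thesis by blast
  qed
  have "P (Suc n) \<subseteq> P n" for n using nest[of n] by auto
  then have "P n \<subseteq> P m" if "m \<le> n" for m n
    using lift_Suc_antimono_le[of P] that by blast
  then obtain a where a: "\<And>n. a \<in> P n"
    using decreasing_closed_nest[of P] assms(1,2) small by metis
  moreover have "\<exists>n. P n \<subseteq> ball a e" if "e > 0" for e
    using small[OF that] a by (metis mem_ball subsetI)
  ultimately show ?thesis using that by blast
qed

text \<open>An inseparable pair can be shrunk to pieces of vanishing diameter and remain
  inseparable. The two limit points have distinct images, and disjoint neighbourhoods of these
  images separate late pieces, a contradiction.\<close>

lemma borel_separated_closed_images:
  fixes C1 :: "'a::{complete_space, second_countable_topology} set"
    and C2 :: "'b::{complete_space, second_countable_topology} set"
    and \<phi> :: "'a \<Rightarrow> 'c::t2_space" and \<psi> :: "'b \<Rightarrow> 'c"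
  assumes "closed C1" "closed C2"
    and \<phi>: "continuous_on UNIV \<phi>" and \<psi>: "continuous_on UNIV \<psi>"
    and disj: "\<phi> ` C1 \<inter> \<psi> ` C2 = {}"
  shows "borel_separated (\<phi> ` C1) (\<psi> ` C2)"
proof (rule ccontr)
  assume nsep: "\<not> ?thesis"
  define ok where "ok = (\<lambda>(P, Q). closed P \<and> closed Q \<and> P \<subseteq> C1 \<and> Q \<subseteq> C2 \<and>
    \<not> borel_separated (\<phi> ` P) (\<psi> ` Q))"
  define step :: "nat \<Rightarrow> 'a set \<times> 'b set \<Rightarrow> 'a set \<times> 'b set \<Rightarrow> bool" where
    "step n = (\<lambda>(P, Q) (P', Q').
      (\<exists>a. P' = P \<inter> cball a (inverse (real (Suc n)))) \<and>
      (\<exists>b. Q' = Q \<inter> cball b (inverse (real (Suc n)))))" for n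
  have "\<exists>F. \<forall>n. ok (F n) \<and> step n (F n) (F (Suc n))"
  proof (rule dependent_nat_choice)
    have "ok (C1, C2)" using assms(1,2) nsep by (simp add: ok_def)
    then show "\<exists>x. ok x" ..
  next
    fix x n assume "ok x"
    obtain P Q where x: "x = (P, Q)" by force
    have *: "closed P" "closed Q" "P \<subseteq> C1" "Q \<subseteq> C2" "\<not> borel_separated (\<phi> ` P) (\<psi> ` Q)"
      using \<open>ok x\<close> by (auto simp: x ok_def)
    define e where "e = inverse (real (Suc n))"
    have "e > 0" by (simp add: e_def)
    then obtain a b where "\<not> borel_separated (\<phi> ` (P \<inter> cball a e)) (\<psi> ` (Q \<inter> cball b e))"
      using not_borel_separated_small[OF *(5)] by blast
    then have "ok (P \<inter> cball a e, Q \<inter> cball b e)"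
      using *(1-4) by (simp add: ok_def closed_Int le_infI1)
    moreover have "step n x (P \<inter> cball a e, Q \<inter> cball b e)"
      unfolding x step_def prod.case e_def by blast
    ultimately show "\<exists>y. ok y \<and> step n x y" by blast
  qed
  then obtain F where F: "\<And>n. ok (F n)" "\<And>n. step n (F n) (F (Suc n))" by metis
  define P where "P n = fst (F n)" for n
  define Q where "Q n = snd (F n)" for n
  have ok: "closed (P n)" "closed (Q n)" "P n \<subseteq> C1" "Q n \<subseteq> C2"
    "\<not> borel_separated (\<phi> ` P n) (\<psi> ` Q n)" for n
    using F(1)[of n] by (simp_all only: ok_def P_def Q_def case_prod_beta simp_thms)
  have nestP: "\<exists>a. P (Suc n) = P n \<inter> cball a (inverse (real (Suc n)))"
    and nestQ: "\<exists>b. Q (Suc n) = Q n \<inter> cball b (inverse (real (Suc n)))" for n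
    using F(2)[of n] by (simp_all only: step_def P_def Q_def case_prod_beta)
  \<comment> \<open>An empty piece would be separated trivially.\<close>
  have "P n \<noteq> {}" for n
    using ok(5)[of n] by (auto simp: borel_separated_empty)
  from closed_nest_halving[of P, OF ok(1) this nestP]
  obtain a where a: "\<And>n. a \<in> P n" "\<And>e. e > 0 \<Longrightarrow> \<exists>n. P n \<subseteq> ball a e"
    by blast
  have "Q n \<noteq> {}" for n
    using ok(5)[of n] by (auto simp: borel_separated_empty)
  from closed_nest_halving[of Q, OF ok(2) this nestQ]
  obtain b where b: "\<And>n. b \<in> Q n" "\<And>e. e > 0 \<Longrightarrow> \<exists>n. Q n \<subseteq> ball b e"
    by blast
  have "\<phi> a \<noteq> \<psi> b" using a(1)[of 0] b(1)[of 0] ok(3,4)[of 0] disj by blast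
  from hausdorff[OF this] obtain U V where UV: "open U" "open V" "\<phi> a \<in> U" "\<psi> b \<in> V" "U \<inter> V = {}"
    by blast
  have "open (\<phi> -` U)" "open (\<psi> -` V)" "a \<in> \<phi> -` U" "b \<in> \<psi> -` V"
    using UV(1-4) \<phi> \<psi> by (auto intro: open_vimage)
  then obtain e1 e2 where e: "e1 > 0" "ball a e1 \<subseteq> \<phi> -` U" "e2 > 0" "ball b e2 \<subseteq> \<psi> -` V"
    by (elim openE) blast
  obtain n m where n: "P n \<subseteq> ball a e1" and m: "Q m \<subseteq> ball b e2"
    using a(2)[OF e(1)] b(2)[OF e(3)] by blast
  have mono: "P (Suc n) \<subseteq> P n" "Q (Suc n) \<subseteq> Q n" for n using nestP[of n] nestQ[of n] by auto
  have "P (max n m) \<subseteq> P n" "Q (max n m) \<subseteq> Q m"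
    using lift_Suc_antimono_le[of P n "max n m"] lift_Suc_antimono_le[of Q m "max n m"] mono by auto
  then have "\<phi> ` P (max n m) \<subseteq> U" "\<psi> ` Q (max n m) \<subseteq> V"
    using n m e(2,4) by blast+
  then have "borel_separated (\<phi> ` P (max n m)) (\<psi> ` Q (max n m))"
    unfolding borel_separated_def using UV by (intro bexI[of _ U]) auto
  then show False using ok(5) by blast
qed

text \<open>Borel sets are projections of closed sets, and composing the projection with a
  continuous map reduces the claim to closed sets.\<close>

lemma lusin_separation:
  fixes A :: "'a::{complete_space, second_countable_topology} set"
    and B :: "'b::{complete_space, second_countable_topology} set"
    and \<phi> :: "'a \<Rightarrow> 'c::t2_space" and \<psi> :: "'b \<Rightarrow> 'c"
  assumes "A \<in> sets borel" "B \<in> sets borel"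
    and \<phi>: "continuous_on UNIV \<phi>" and \<psi>: "continuous_on UNIV \<psi>"
    and disj: "\<phi> ` A \<inter> \<psi> ` B = {}"
  shows "borel_separated (\<phi> ` A) (\<psi> ` B)"
proof -
  obtain C1 :: "('a \<times> (nat \<Rightarrow> real)) set" and C2 :: "('b \<times> (nat \<Rightarrow> real)) set"
    where C: "closed C1" "A = fst ` C1" "closed C2" "B = fst ` C2"
    using souslin_borel[OF assms(1)] souslin_borel[OF assms(2)] unfolding souslin_def by blast
  have "borel_separated ((\<lambda>p. \<phi> (fst p)) ` C1) ((\<lambda>p. \<psi> (fst p)) ` C2)"
    using disj C
    by (intro borel_separated_closed_images continuous_on_compose2[OF \<phi>] continuous_on_compose2[OF \<psi>]
        continuous_intros) (auto simp: image_image)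
  then show ?thesis using C by (simp add: image_image)
qed

subsection \<open>Sequences along a set of natural numbers\<close>

text \<open>Written with \<open>LEAST\<close> clauses so that measurability in \<open>L\<close>
  follows by induction on the index; on infinite sets it is \<open>enumerate\<close>.\<close>

primrec nth_elem :: "(nat \<Rightarrow> bool) \<Rightarrow> nat \<Rightarrow> nat" where
  "nth_elem L 0 = (LEAST n. L n)"
| "nth_elem L (Suc k) = (LEAST n. L n \<and> nth_elem L k < n)"

lemma nth_elem_eq_enumerate:
  "infinite (Collect L) \<Longrightarrow> nth_elem L k = enumerate (Collect L) k"
  by (induction k) (simp_all add: enumerate_0 enumerate_Suc'' del: enumerate_Suc)

lemma measurable_nth_elem [measurable (raw)]:
  assumes [measurable]: "\<And>n. Measurable.pred M (\<lambda>w. L w n)"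
  shows "(\<lambda>w. nth_elem (L w) k) \<in> measurable M (count_space UNIV)"
  by (induction k) simp_all

definition subval :: "(nat \<Rightarrow> 'a \<Rightarrow> real) \<Rightarrow> (nat \<Rightarrow> bool) \<Rightarrow> 'a \<Rightarrow> nat \<Rightarrow> real" where
  "subval f L x k = f (nth_elem L k) x"

text \<open>\<open>nth_elem\<close> takes countably many values, and where its value is
  \<open>n\<close> the term is \<open>f n\<close> composed with \<open>\<xi>\<close>.\<close>

lemma measurable_subval [measurable (raw)]:
  assumes f: "\<And>n. f n \<in> borel_measurable borel"
    and [measurable]: "\<And>n. Measurable.pred M (\<lambda>w. L w n)" and \<xi>: "\<xi> \<in> measurable M borel"
  shows "(\<lambda>w. subval f (L w) (\<xi> w) k) \<in> borel_measurable M"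
  unfolding subval_def
  by (rule measurable_compose_countable[where f = "\<lambda>n w. f n (\<xi> w)"])
    (use measurable_compose[OF \<xi> f] in measurable)

text \<open>The Cauchy criterion with tolerances 1/(j+1) quantifies only over natural
  numbers.\<close>

lemma measurable_convergent_subval [measurable (raw)]:
  assumes [measurable]: "\<And>n. f n \<in> borel_measurable borel"
    "\<And>n. Measurable.pred M (\<lambda>w. L w n)" "\<xi> \<in> measurable M borel"
  shows "Measurable.pred M (\<lambda>w. convergent (subval f (L w) (\<xi> w)))"
  unfolding Cauchy_convergent_iff[symmetric] metric_Cauchy_iff2 by measurable

lemma measurable_lim_subval [measurable (raw)]:
  assumes [measurable]: "\<And>n. f n \<in> borel_measurable borel"
    "\<And>n. Measurable.pred M (\<lambda>w. L w n)" "\<xi> \<in> measurable M borel"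
  shows "(\<lambda>w. lim (subval f (L w) (\<xi> w))) \<in> borel_measurable M"
  using borel_measurable_lim_metric[of "\<lambda>k w. subval f (L w) (\<xi> w) k" M] by simp

lemma measurable_infinite_Collect [measurable (raw)]:
  fixes L :: "'a \<Rightarrow> nat \<Rightarrow> bool"
  assumes [measurable]: "\<And>n. Measurable.pred M (\<lambda>w. L w n)"
  shows "Measurable.pred M (\<lambda>w. infinite (Collect (L w)))"
  unfolding infinite_nat_iff_unbounded mem_Collect_eq by measurable

lemma borel_measurable_baire1: "baire1 f \<Longrightarrow> f \<in> borel_measurable borel"
  unfolding baire1_def
  by (metis borel_measurable_LIMSEQ_metric borel_measurable_continuous_onI)

subsection \<open>Cluster functions in pointwise compact sets\<close>

text \<open>Compactness gives a cluster point of \<open>u\<close> along \<open>F\<close>, and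
  evaluation at a point is continuous. A filter is used because compactness alone need not yield a
  pointwise convergent subsequence.\<close>

lemma compact_cluster_function:
  fixes K :: "('a \<Rightarrow> real) set"
  assumes "compact K" "\<And>k. u k \<in> K" "F \<noteq> bot"
  obtains h where "h \<in> K" "\<And>x S. closed S \<Longrightarrow> eventually (\<lambda>k. u k x \<in> S) F \<Longrightarrow> h x \<in> S"
    "\<And>x l. ((\<lambda>k. u k x) \<longlongrightarrow> l) F \<Longrightarrow> h x = l"
proof -
  have "\<exists>h\<in>K. inf (nhds h) (filtermap u F) \<noteq> bot"
    using assms unfolding compact_filter by (auto simp: filtermap_bot_iff eventually_filtermap)
  then obtain h where h: "h \<in> K" "inf (nhds h) (filtermap u F) \<noteq> bot" by blast
  have cl: "h x \<in> S" if "closed S" "eventually (\<lambda>k. u k x \<in> S) F" for x S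
  proof (rule ccontr)
    assume "h x \<notin> S"
    have "open ((\<lambda>g :: 'a \<Rightarrow> real. g x) -` (- S))"
      using that(1) by (intro open_vimage) auto
    then have "eventually (\<lambda>g. g x \<in> - S) (nhds h)"
      using \<open>h x \<notin> S\<close> unfolding eventually_nhds by (force intro: exI[of _ "(\<lambda>g. g x) -` (- S)"])
    moreover have "eventually (\<lambda>g. g x \<in> S) (filtermap u F)"
      using that(2) by (simp add: eventually_filtermap)
    ultimately have "eventually (\<lambda>_. False) (inf (nhds h) (filtermap u F))"
      unfolding eventually_inf by blast
    then show False using h(2) by (simp add: eventually_False)
  qed
  have "h x = l" if "((\<lambda>k. u k x) \<longlongrightarrow> l) F" for x l
  proof (rule ccontr)
    assume "h x \<noteq> l"
    then have "eventually (\<lambda>k. dist (u k x) l < dist (h x) l / 2) F"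
      by (intro tendstoD[OF that]) simp
    then have "eventually (\<lambda>k. u k x \<in> cball l (dist (h x) l / 2)) F"
      by eventually_elim (simp add: dist_commute)
    then have "h x \<in> cball l (dist (h x) l / 2)" by (rule cl[rotated]) simp
    then show False using \<open>h x \<noteq> l\<close> by (simp add: dist_commute)
  qed
  with cl h(1) that show ?thesis by blast
qed

lemma closure_range_pointwise:
  fixes f :: "nat \<Rightarrow> 'a \<Rightarrow> real"
  assumes "g \<in> closure (range f)" "finite S" "e > 0"
  shows "\<exists>n. \<forall>z\<in>S. \<bar>f n z - g z\<bar> < e"
proof -
  have "open {h. \<forall>z\<in>S. h (id z) \<in> ball (g z) e}"
    by (rule product_topology_basis') (use assms in auto)
  moreover have "g \<in> {h. \<forall>z\<in>S. h (id z) \<in> ball (g z) e}" using assms(3) by simp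
  ultimately have "{h. \<forall>z\<in>S. h (id z) \<in> ball (g z) e} \<inter> range f \<noteq> {}"
    using assms(1) open_Int_closure_eq_empty by blast
  then obtain n where "\<forall>z\<in>S. f n z \<in> ball (g z) e" by auto
  then show ?thesis by (intro exI[of _ n]) (simp add: dist_real_def abs_minus_commute)
qed

text \<open>The approximant with number \<open>k\<close> is accurate at the points of
  \<open>D\<close> with index below \<open>k\<close>, so each fixed point of \<open>D\<close> is
  eventually covered. A cluster function of the approximants equals \<open>l\<close> on
  \<open>D\<close>, and the closed condition at \<open>x\<close> passes to it.\<close>

lemma exists_limit_away:
  fixes f :: "nat \<Rightarrow> 'a \<Rightarrow> real"
  assumes "compact K" "range f \<subseteq> K"
    and approx: "\<And>k. \<exists>n. (\<forall>z\<in>D. to_nat_on D z < k \<longrightarrow> \<bar>f n z - l z\<bar> < inverse (real (Suc k))) \<and>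
          e \<le> \<bar>f n x - a\<bar>"
  shows "\<exists>g\<in>K. (\<forall>z\<in>D. g z = l z) \<and> e \<le> \<bar>g x - a\<bar>"
proof -
  obtain n where n: "\<And>k z. z \<in> D \<Longrightarrow> to_nat_on D z < k \<Longrightarrow> \<bar>f (n k) z - l z\<bar> < inverse (real (Suc k))"
    "\<And>k. e \<le> \<bar>f (n k) x - a\<bar>"
    using approx by metis
  obtain g where g: "g \<in> K"
    "\<And>x S. closed S \<Longrightarrow> eventually (\<lambda>k. f (n k) x \<in> S) sequentially \<Longrightarrow> g x \<in> S"
    "\<And>x l. (\<lambda>k. f (n k) x) \<longlonglongrightarrow> l \<Longrightarrow> g x = l"
    using compact_cluster_function[of K "\<lambda>k. f (n k)" sequentially] assms(1,2)
    by (metis rangeI sequentially_bot subsetD)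
  have "g z = l z" if "z \<in> D" for z
  proof (rule g(3))
    have "(\<lambda>k. f (n k) z - l z) \<longlonglongrightarrow> 0"
    proof (rule Lim_null_comparison[OF _ LIMSEQ_inverse_real_of_nat])
      show "eventually (\<lambda>k. norm (f (n k) z - l z) \<le> inverse (real (Suc k))) sequentially"
        using eventually_gt_at_top[of "to_nat_on D z"]
        by eventually_elim (use n(1)[OF that] in \<open>auto intro: less_imp_le\<close>)
    qed
    then show "(\<lambda>k. f (n k) z) \<longlonglongrightarrow> l z" by (simp add: LIM_zero_iff)
  qed
  moreover have "g x \<in> {t. e \<le> \<bar>t - a\<bar>}"
    using n(2) by (intro g(2) closed_Collect_le continuous_intros) auto
  ultimately show ?thesis using g(1) by auto
qed

text \<open>A sequence failing to converge at \<open>y\<close> has two cluster points differing at \<open>y\<close>; together with \<open>g\<close>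
  they would be three functions of \<open>K\<close> coinciding on \<open>D\<close>.\<close>

lemma convergent_if_second_limit:
  fixes K :: "('a \<Rightarrow> real) set"
  assumes K: "compact K" "\<And>k. u k \<in> K"
    and fin: "finite {h\<in>K. \<forall>x\<in>D. h x = g x}" and card: "card {h\<in>K. \<forall>x\<in>D. h x = g x} \<le> 2"
    and g: "g \<in> K" "\<And>z. z \<in> D \<Longrightarrow> (\<lambda>k. u k z) \<longlonglongrightarrow> g z"
    and x: "(\<lambda>k. u k x) \<longlonglongrightarrow> a" "g x \<noteq> a"
  shows "convergent (\<lambda>k. u k y)"
proof (rule ccontr)
  assume nconv: "\<not> convergent (\<lambda>k. u k y)"
  obtain h1 where h1: "h1 \<in> K" "\<And>x l. (\<lambda>k. u k x) \<longlonglongrightarrow> l \<Longrightarrow> h1 x = l"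
    using compact_cluster_function[of K u sequentially] K by (metis sequentially_bot)
  have "\<not> (\<lambda>k. u k y) \<longlonglongrightarrow> h1 y" using nconv by (auto simp: convergent_def)
  then obtain e where e: "e > 0" "\<not> eventually (\<lambda>k. dist (u k y) (h1 y) < e) sequentially"
    unfolding tendsto_iff by blast
  \<comment> \<open>Restricting to the indices where the values at \<open>y\<close> stay
    \<open>e\<close> away from \<open>h1 y\<close> gives a proper filter, hence a second cluster
    function.\<close>
  define F where "F = inf sequentially (principal {k. e \<le> dist (u k y) (h1 y)})"
  have "F \<noteq> bot"
    using e(2) by (auto simp: F_def trivial_limit_def eventually_inf_principal not_le)
  then obtain h2 where h2: "h2 \<in> K"
    "\<And>x S. closed S \<Longrightarrow> eventually (\<lambda>k. u k x \<in> S) F \<Longrightarrow> h2 x \<in> S"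
    "\<And>x l. ((\<lambda>k. u k x) \<longlongrightarrow> l) F \<Longrightarrow> h2 x = l"
    using compact_cluster_function[of K u F] K by metis
  have h2': "h2 x = l" if "(\<lambda>k. u k x) \<longlonglongrightarrow> l" for x l
    using that by (intro h2(3) tendsto_mono[of F sequentially]) (simp_all add: F_def)
  have "h2 y \<in> {t. e \<le> dist t (h1 y)}"
    by (intro h2(2) closed_Collect_le continuous_intros) (simp add: F_def eventually_inf_principal)
  then have "h2 \<noteq> h1" using e(1) by auto
  \<comment> \<open>At \<open>x\<close> both cluster functions take the value \<open>a\<close>,
    which \<open>g\<close> avoids.\<close>
  moreover have "h1 \<noteq> g" "h2 \<noteq> g" using h1(2)[OF x(1)] h2'[OF x(1)] x(2) by auto
  moreover have "card {g, h1, h2} \<le> 2"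
  proof (rule order_trans[OF card_mono[OF fin] card])
    have "h1 z = g z" "h2 z = g z" if "z \<in> D" for z
      using h1(2)[OF g(2)[OF that]] h2'[OF g(2)[OF that]] by simp_all
    then show "{g, h1, h2} \<subseteq> {h\<in>K. \<forall>x\<in>D. h x = g x}"
      using g(1) h1(1) h2(1) by simp
  qed
  ultimately show False by simp
qed

text \<open>Isolates an exceptional limit inside its finite fibre over \<open>D\<close>, by one
  point for each competitor.\<close>

lemma finite_determining_points:
  fixes T :: "('a \<Rightarrow> 'b) set"
  assumes "finite T"
  obtains Q where "finite Q" "\<And>h. h \<in> T \<Longrightarrow> (\<And>x. x \<in> Q \<Longrightarrow> h x = d x) \<Longrightarrow> h = d"
proof
  \<comment> \<open>If \<open>h = d\<close>, \<open>SOME\<close> returns an arbitrary point, which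
    is harmless.\<close>
  show "finite ((\<lambda>h. SOME x. h x \<noteq> d x) ` T)" using assms by simp
next
  fix h assume h: "h \<in> T" "\<And>x. x \<in> (\<lambda>h. SOME x. h x \<noteq> d x) ` T \<Longrightarrow> h x = d x"
  show "h = d"
  proof (rule ccontr)
    assume "h \<noteq> d"
    then have "\<exists>x. h x \<noteq> d x" by blast
    then have "h (SOME x. h x \<noteq> d x) \<noteq> d (SOME x. h x \<noteq> d x)" by (rule someI_ex)
    then show False using h by blast
  qed
qed

text \<open>Every cluster function of \<open>u\<close> agrees with \<open>d\<close> on
  \<open>D\<close> and so equals \<open>d\<close>, whereas failure of convergence at
  \<open>y\<close> would produce one that differs from \<open>d\<close> at \<open>y\<close>.\<close>

lemma tendsto_if_determined:
  fixes K :: "('a \<Rightarrow> real) set"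
  assumes K: "compact K" "\<And>k. u k \<in> K"
    and det: "\<And>h. h \<in> K \<Longrightarrow> (\<And>x. x \<in> D \<Longrightarrow> h x = d x) \<Longrightarrow> h = d"
    and lim: "\<And>z. z \<in> D \<Longrightarrow> (\<lambda>k. u k z) \<longlonglongrightarrow> d z"
  shows "(\<lambda>k. u k y) \<longlonglongrightarrow> d y"
proof (rule ccontr)
  assume "\<not> ?thesis"
  then obtain e where e: "e > 0" "\<not> eventually (\<lambda>k. dist (u k y) (d y) < e) sequentially"
    unfolding tendsto_iff by blast
  define F where "F = inf sequentially (principal {k. e \<le> dist (u k y) (d y)})"
  have "F \<noteq> bot"
    using e(2) by (auto simp: F_def trivial_limit_def eventually_inf_principal not_le)
  then obtain h where h: "h \<in> K"
    "\<And>x S. closed S \<Longrightarrow> eventually (\<lambda>k. u k x \<in> S) F \<Longrightarrow> h x \<in> S"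
    "\<And>x l. ((\<lambda>k. u k x) \<longlongrightarrow> l) F \<Longrightarrow> h x = l"
    using compact_cluster_function[of K u F] K by metis
  have "h = d"
  proof (rule det[OF h(1)])
    fix x assume "x \<in> D"
    show "h x = d x"
      using lim[OF \<open>x \<in> D\<close>] by (intro h(3) tendsto_mono[of F sequentially]) (simp_all add: F_def)
  qed
  moreover have "h y \<in> {t. e \<le> dist t (d y)}"
    by (intro h(2) closed_Collect_le continuous_intros) (simp add: F_def eventually_inf_principal)
  ultimately show False using e(1) by simp
qed

subsection \<open>Existence of a second limit\<close>

text \<open>The last conjunct expresses that some function in \<open>K\<close> extends the limit on \<open>D\<close> but differs from it
  at \<open>x\<close>. Phrasing this through approximations by the \<open>f n\<close> avoids quantifying over \<open>K\<close>, so that the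
  relation is Borel in \<open>L\<close> and \<open>x\<close>.\<close>

definition other_limit :: "(nat \<Rightarrow> 'a \<Rightarrow> real) \<Rightarrow> 'a set \<Rightarrow> (nat \<Rightarrow> bool) \<Rightarrow> 'a \<Rightarrow> bool" where
  "other_limit f D L x \<longleftrightarrow> infinite (Collect L) \<and> (\<forall>z\<in>D. convergent (subval f L z)) \<and>
    convergent (subval f L x) \<and>
    (\<exists>j. \<forall>k. \<exists>n. (\<forall>z\<in>D. to_nat_on D z < k \<longrightarrow> \<bar>f n z - lim (subval f L z)\<bar> < inverse (real (Suc k))) \<and>
       inverse (real (Suc j)) \<le> \<bar>f n x - lim (subval f L x)\<bar>)"

lemma measurable_other_limit:
  assumes [measurable]: "\<And>n. f n \<in> borel_measurable borel"
    "\<And>n. Measurable.pred M (\<lambda>w. L w n)" "\<xi> \<in> measurable M borel" and [measurable]: "countable D"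
  shows "Measurable.pred M (\<lambda>w. other_limit f D (L w) (\<xi> w))"
  unfolding other_limit_def by measurable

text \<open>Compactness turns the approximations into a function \<open>g\<close> of
  \<open>K\<close>, to which \<open>convergent_if_second_limit\<close> applies. This makes the two
  projections to be separated disjoint.\<close>

lemma convergent_if_other_limit:
  fixes K :: "('a \<Rightarrow> real) set"
  assumes K: "compact K" "range f \<subseteq> K"
    and deg: "\<And>g. g \<in> K \<Longrightarrow> finite {h\<in>K. \<forall>x\<in>D. h x = g x} \<and> card {h\<in>K. \<forall>x\<in>D. h x = g x} \<le> 2"
    and L: "other_limit f D L x"
  shows "convergent (subval f L y)"
proof -
  obtain j where "\<And>k. \<exists>n. (\<forall>z\<in>D. to_nat_on D z < k \<longrightarrow>
        \<bar>f n z - lim (subval f L z)\<bar> < inverse (real (Suc k))) \<and>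
       inverse (real (Suc j)) \<le> \<bar>f n x - lim (subval f L x)\<bar>"
    using L unfolding other_limit_def by blast
  from exists_limit_away[OF K this]
  obtain g where g: "g \<in> K" "\<forall>z\<in>D. g z = lim (subval f L z)"
    "inverse (real (Suc j)) \<le> \<bar>g x - lim (subval f L x)\<bar>"
    by blast
  have eq: "subval f L z = (\<lambda>k. f (nth_elem L k) z)" for z
    by (simp add: subval_def fun_eq_iff)
  have "convergent (\<lambda>k. f (nth_elem L k) y)"
  proof (rule convergent_if_second_limit[where g = g and D = D and x = x, OF K(1)])
    show "f (nth_elem L k) \<in> K" for k using K(2) by blast
    show "finite {h\<in>K. \<forall>x\<in>D. h x = g x}" "card {h\<in>K. \<forall>x\<in>D. h x = g x} \<le> 2"
      using deg[OF g(1)] by simp_all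
    show "(\<lambda>k. f (nth_elem L k) z) \<longlonglongrightarrow> g z" if "z \<in> D" for z
      using L g(2) that unfolding other_limit_def eq by (simp add: convergent_LIMSEQ_iff)
    show "(\<lambda>k. f (nth_elem L k) x) \<longlonglongrightarrow> lim (subval f L x)"
      using L unfolding other_limit_def eq by (simp add: convergent_LIMSEQ_iff)
    have "inverse (real (Suc j)) > 0" by simp
    then show "g x \<noteq> lim (subval f L x)" using g(3) by linarith
  qed (rule g(1))
  then show ?thesis by (simp add: eq)
qed

text \<open>Density supplies the approximations: a basic neighbourhood of \<open>g\<close> may
  prescribe the values at \<open>x\<close> and at finitely many points of \<open>D\<close>
  together.\<close>

lemma other_limit_if_second_function:
  assumes cD: "countable D" and L: "infinite (Collect L)" "\<And>z. subval f L z \<longlonglongrightarrow> h z"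
    and g: "g \<in> closure (range f)" "\<And>z. z \<in> D \<Longrightarrow> g z = h z" "g x \<noteq> h x"
  shows "other_limit f D L x"
proof -
  \<comment> \<open>Half the gap: if \<open>f n x\<close> is within \<open>e\<close> of
    \<open>g x\<close>, it is at least \<open>e\<close> away from \<open>h x\<close>.\<close>
  define e where "e = \<bar>g x - h x\<bar> / 2"
  have "e > 0" using g(3) by (simp add: e_def)
  then obtain j where j: "inverse (real (Suc j)) < e"
    using reals_Archimedean by blast
  have lim: "lim (subval f L z) = h z" for z using L(2) by (rule limI)
  have "\<exists>n. (\<forall>z\<in>D. to_nat_on D z < k \<longrightarrow> \<bar>f n z - lim (subval f L z)\<bar> < inverse (real (Suc k))) \<and>
       inverse (real (Suc j)) \<le> \<bar>f n x - lim (subval f L x)\<bar>" for k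
  proof -
    have "{z\<in>D. to_nat_on D z < k} \<subseteq> from_nat_into D ` {..<k}"
      using cD by (force intro: image_eqI[of _ _ "to_nat_on D _"])
    then have fin: "finite {z\<in>D. to_nat_on D z < k}" by (rule finite_subset) simp
    obtain n where n: "\<forall>z\<in>insert x {z\<in>D. to_nat_on D z < k}. \<bar>f n z - g z\<bar> < min e (inverse (real (Suc k)))"
      using closure_range_pointwise[OF g(1), of "insert x {z\<in>D. to_nat_on D z < k}" "min e (inverse (real (Suc k)))"]
        fin \<open>e > 0\<close> by auto
    have "\<bar>f n x - g x\<bar> < e" using n by simp
    moreover have "\<bar>g x - h x\<bar> = 2 * e" by (simp add: e_def)
    ultimately have "e \<le> \<bar>f n x - h x\<bar>" by linarith
    then show ?thesis using n j g(2) by (intro exI[of _ n]) (auto simp: lim)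
  qed
  then show ?thesis using L unfolding other_limit_def by (auto simp: convergent_def)
qed

section \<open>Passage to the Cantor space\<close>

lemma pred_coordinate: "Measurable.pred borel (\<lambda>L :: nat \<Rightarrow> bool. L n)"
proof -
  have "open ((\<lambda>L :: nat \<Rightarrow> bool. L n) -` {True})"
    by (intro open_vimage) (auto simp: open_discrete)
  then have "{L :: nat \<Rightarrow> bool. L n} \<in> sets borel" by (simp add: vimage_def)
  then show ?thesis by (simp add: pred_def)
qed

text \<open>The types \<open>bool\<close> and \<open>nat\<close> carry no metric in the library, so subsets of \<open>nat\<close> are coded by real
  sequences in order to apply the separation theorem.\<close>

lemma borel_separated_projections:
  fixes P R :: "(nat \<Rightarrow> bool) \<Rightarrow> 'a::polish_space \<Rightarrow> bool"
  assumes P: "\<And>(M :: ((nat \<Rightarrow> real) \<times> 'a) measure) L \<xi>. (\<And>n. Measurable.pred M (\<lambda>w. L w n)) \<Longrightarrow>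
      \<xi> \<in> measurable M borel \<Longrightarrow> Measurable.pred M (\<lambda>w. P (L w) (\<xi> w))"
    and R: "\<And>(M :: ((nat \<Rightarrow> real) \<times> 'a) measure) L \<xi>. (\<And>n. Measurable.pred M (\<lambda>w. L w n)) \<Longrightarrow>
      \<xi> \<in> measurable M borel \<Longrightarrow> Measurable.pred M (\<lambda>w. R (L w) (\<xi> w))"
    and disj: "\<And>L x y. P L x \<Longrightarrow> \<not> R L y"
  shows "borel_separated {L. \<exists>x. P L x} {L. \<exists>x. R L x}"
proof -
  \<comment> \<open>The decoding \<open>\<theta>\<close> is Borel on all real sequences, and the
    coding \<open>\<iota>\<close> is a continuous right inverse of it. Separation is done among real
    sequences and pulled back along \<open>\<iota>\<close>.\<close>
  define \<theta> :: "(nat \<Rightarrow> real) \<Rightarrow> nat \<Rightarrow> bool" where "\<theta> y n \<longleftrightarrow> 1 / 2 < y n" for y n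
  define \<iota> :: "(nat \<Rightarrow> bool) \<Rightarrow> nat \<Rightarrow> real" where "\<iota> L n = of_bool (L n)" for L n
  have \<theta>\<iota>: "\<theta> (\<iota> L) = L" for L by (simp add: \<theta>_def \<iota>_def fun_eq_iff)
  have "continuous_on UNIV (\<lambda>w :: (nat \<Rightarrow> real) \<times> 'a. fst w n)" for n
    by (rule continuous_on_product_then_coordinatewise[OF continuous_on_fst[OF continuous_on_id]])
  then have [measurable]: "(\<lambda>w :: (nat \<Rightarrow> real) \<times> 'a. fst w n) \<in> borel_measurable borel" for n
    by (rule borel_measurable_continuous_onI)
  have \<theta>: "Measurable.pred borel (\<lambda>w :: (nat \<Rightarrow> real) \<times> 'a. \<theta> (fst w) n)" for n
    unfolding \<theta>_def by measurable
  have snd: "(snd :: (nat \<Rightarrow> real) \<times> 'a \<Rightarrow> 'a) \<in> borel_measurable borel"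
    by (rule borel_measurable_continuous_onI[OF continuous_on_snd[OF continuous_on_id]])
  have "borel_separated (fst ` {w :: (nat \<Rightarrow> real) \<times> 'a. P (\<theta> (fst w)) (snd w)})
      (fst ` {w :: (nat \<Rightarrow> real) \<times> 'a. R (\<theta> (fst w)) (snd w)})"
  proof (rule lusin_separation)
    show "{w :: (nat \<Rightarrow> real) \<times> 'a. P (\<theta> (fst w)) (snd w)} \<in> sets borel"
      using P[OF \<theta> snd] by (simp add: pred_def)
    show "{w :: (nat \<Rightarrow> real) \<times> 'a. R (\<theta> (fst w)) (snd w)} \<in> sets borel"
      using R[OF \<theta> snd] by (simp add: pred_def)
  qed (use disj in \<open>auto simp: continuous_on_fst[OF continuous_on_id]\<close>)
  then obtain S where S: "S \<in> sets borel"
    "fst ` {w :: (nat \<Rightarrow> real) \<times> 'a. P (\<theta> (fst w)) (snd w)} \<subseteq> S"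
    "S \<inter> fst ` {w :: (nat \<Rightarrow> real) \<times> 'a. R (\<theta> (fst w)) (snd w)} = {}"
    unfolding borel_separated_def by blast
  have "continuous_on UNIV (of_bool :: bool \<Rightarrow> real)"
    by (simp add: continuous_on_open_vimage open_discrete)
  then have "continuous_on UNIV (\<lambda>L. \<iota> L n)" for n
    unfolding \<iota>_def by (rule continuous_on_compose2[OF _ continuous_on_product_coordinates]) simp
  then have "continuous_on UNIV \<iota>"
    by (rule continuous_on_coordinatewise_then_product)
  then have "\<iota> \<in> borel_measurable borel" by (rule borel_measurable_continuous_onI)
  from measurable_sets[OF this S(1)] have "\<iota> -` S \<in> sets borel" by simp
  moreover have "{L. \<exists>x. P L x} \<subseteq> \<iota> -` S"
  proof safe
    fix L x assume "P L x"
    then have "(\<iota> L, x) \<in> {w. P (\<theta> (fst w)) (snd w)}" by (simp add: \<theta>\<iota>)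
    then have "\<iota> L \<in> fst ` {w. P (\<theta> (fst w)) (snd w)}" by (rule image_eqI[rotated]) simp
    then show "L \<in> \<iota> -` S" using S(2) by auto
  qed
  moreover have "\<iota> -` S \<inter> {L. \<exists>x. R L x} = {}"
  proof safe
    fix L x assume "R L x" "\<iota> L \<in> S"
    then have "(\<iota> L, x) \<in> {w. R (\<theta> (fst w)) (snd w)}" by (simp add: \<theta>\<iota>)
    then have "\<iota> L \<in> fst ` {w. R (\<theta> (fst w)) (snd w)}" by (rule image_eqI[rotated]) simp
    then show "L \<in> {}" using S(3) \<open>\<iota> L \<in> S\<close> by blast
  qed
  ultimately show ?thesis unfolding borel_separated_def by blast
qed

theorem theorem5p2:
  fixes K :: "('a::polish_space \<Rightarrow> real) set"
    and f :: "nat \<Rightarrow> 'a \<Rightarrow> real"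
  assumes "rosenthal_compact K"
    and "separable_set K"
    and "pre_metric_degree_two K"
    and "range f \<subseteq> K"
    and "K \<subseteq> closure (range f)"
  shows "conv_set f \<in> sets (restrict_space borel inf_subsets)"
proof -
  have K: "compact K" and baire: "\<And>g. g \<in> K \<Longrightarrow> baire1 g"
    using assms(1) by (auto simp: rosenthal_compact_def)
  have f [measurable]: "f n \<in> borel_measurable borel" for n
    using assms(4) by (intro borel_measurable_baire1 baire) auto
  have fK: "f n \<in> K" for n using assms(4) by blast
  obtain D DD where D [measurable]: "countable D" and DD: "countable DD" "DD \<subseteq> K"
    and deg: "\<And>g. g \<in> K \<Longrightarrow> finite {h\<in>K. \<forall>x\<in>D. h x = g x} \<and> card {h\<in>K. \<forall>x\<in>D. h x = g x} \<le> 2"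
    and two: "\<And>h. h \<in> K - DD \<Longrightarrow> \<exists>g\<in>K. g \<noteq> h \<and> (\<forall>x\<in>D. g x = h x)"
    using assms(3) unfolding pre_metric_degree_two_def by (elim exE conjE) (rule that, (erule (1) bspec | assumption)+)
  have eq: "subval f L x = (\<lambda>k. f (nth_elem L k) x)" for L x
    by (simp add: subval_def fun_eq_iff)
  have conv_iff: "L \<in> conv_set f \<longleftrightarrow> infinite (Collect L) \<and> (\<forall>x. convergent (subval f L x))" for L
    by (auto simp: conv_set_def inf_subsets_def eq nth_elem_eq_enumerate)
  \<comment> \<open>The fibre of \<open>d\<close> over \<open>D\<close> is finite, so finitely many
    further points single out \<open>d\<close>.\<close>
  have "\<exists>Q. finite Q \<and> (\<forall>h\<in>K. (\<forall>x\<in>D \<union> Q. h x = d x) \<longrightarrow> h = d)" if "d \<in> DD" for d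
  proof -
    have "finite {h\<in>K. \<forall>x\<in>D. h x = d x}" using deg DD(2) that by blast
    from finite_determining_points[OF this, of d] obtain Q where "finite Q"
      "\<And>h. h \<in> {h\<in>K. \<forall>x\<in>D. h x = d x} \<Longrightarrow> (\<And>x. x \<in> Q \<Longrightarrow> h x = d x) \<Longrightarrow> h = d"
      by blast
    then show ?thesis by (intro exI[of _ Q] conjI ballI impI) auto
  qed
  then obtain Q where Q: "\<And>d. d \<in> DD \<Longrightarrow> finite (Q d)"
    "\<And>d h. d \<in> DD \<Longrightarrow> h \<in> K \<Longrightarrow> \<forall>x\<in>D \<union> Q d. h x = d x \<Longrightarrow> h = d"
    by metis
  \<comment> \<open>For \<open>d\<close> in \<open>DD\<close>, \<open>tendsto_if_determined\<close>
    shows that these are the \<open>L\<close> along which \<open>f\<close> converges everywhere to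
    \<open>d\<close>.\<close>
  define S where "S d = {L. infinite (Collect L) \<and>
      (\<forall>z\<in>D \<union> Q d. convergent (subval f L z) \<and> lim (subval f L z) = d z)}" for d
  define N where "N L x \<longleftrightarrow> infinite (Collect L) \<and> (\<forall>z\<in>D. convergent (subval f L z)) \<and>
      \<not> convergent (subval f L x)" for L x
  define C where "C = {L. infinite (Collect L) \<and> (\<forall>z\<in>D. convergent (subval f L z))}"
  note [measurable] = pred_coordinate
  have S_borel: "S d \<in> sets borel" if "d \<in> DD" for d
  proof -
    have [measurable]: "countable (D \<union> Q d)" using D Q(1)[OF that] by (simp add: countable_finite)
    have "Measurable.pred borel (\<lambda>L. infinite (Collect L) \<and>
      (\<forall>z\<in>D \<union> Q d. convergent (subval f L z) \<and> lim (subval f L z) = d z))"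
      by measurable
    then show ?thesis by (simp add: S_def pred_def)
  qed
  have C_borel: "C \<in> sets borel"
  proof -
    have "Measurable.pred borel (\<lambda>L. infinite (Collect L) \<and> (\<forall>z\<in>D. convergent (subval f L z)))"
      by measurable
    then show ?thesis by (simp add: C_def pred_def)
  qed
  have "borel_separated {L. \<exists>x. other_limit f D L x} {L. \<exists>x. N L x}"
  proof (rule borel_separated_projections)
    fix M :: "((nat \<Rightarrow> real) \<times> 'a) measure" and L :: "_ \<Rightarrow> nat \<Rightarrow> bool" and \<xi> :: "_ \<Rightarrow> 'a"
    assume [measurable]: "\<And>n. Measurable.pred M (\<lambda>w. L w n)" "\<xi> \<in> measurable M borel"
    show "Measurable.pred M (\<lambda>w. other_limit f D (L w) (\<xi> w))"
      by (rule measurable_other_limit) measurable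
    show "Measurable.pred M (\<lambda>w. N (L w) (\<xi> w))"
      unfolding N_def by measurable
  next
    fix L x y assume "other_limit f D L x"
    from convergent_if_other_limit[OF K assms(4) deg this] show "\<not> N L y"
      by (simp add: N_def)
  qed
  then obtain E where E: "E \<in> sets borel" "{L. \<exists>x. other_limit f D L x} \<subseteq> E" "E \<inter> {L. \<exists>x. N L x} = {}"
    unfolding borel_separated_def by blast
  \<comment> \<open>On \<open>C\<close> the sequence converges on \<open>D\<close>, so avoiding the
    projection of \<open>N\<close> amounts to convergence everywhere; hence
    \<open>E \<inter> C\<close> adds nothing outside \<open>conv_set f\<close>. Any limit outside
    \<open>DD\<close> puts \<open>L\<close> into \<open>E\<close>.\<close>
  have "conv_set f = E \<inter> C \<union> (\<Union>d\<in>DD. S d)"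
  proof (intro equalityI subsetI)
    fix L assume "L \<in> conv_set f"
    then have L: "infinite (Collect L)" "\<And>x. convergent (subval f L x)" by (auto simp: conv_iff)
    \<comment> \<open>The pointwise limit lies in \<open>K\<close> because it coincides with a
      cluster function of the sequence.\<close>
    from compact_cluster_function[OF K, of "\<lambda>k. f (nth_elem L k)" sequentially] fK
    obtain h where h: "h \<in> K" "\<And>x l. subval f L x \<longlonglongrightarrow> l \<Longrightarrow> h x = l"
      unfolding eq by (metis sequentially_bot)
    have lim: "subval f L x \<longlonglongrightarrow> h x" for x
      using L(2)[of x] h(2)[of x] by (auto simp: convergent_def)
    show "L \<in> E \<inter> C \<union> (\<Union>d\<in>DD. S d)"
    proof (cases "h \<in> DD")
      case True
      then have "L \<in> S h" using L lim by (auto simp: S_def intro: limI)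
      with True show ?thesis by blast
    next
      case False
      then obtain g where g: "g \<in> K" "g \<noteq> h" "\<forall>x\<in>D. g x = h x" using two h(1) by blast
      then obtain x where "g x \<noteq> h x" by blast
      then have "other_limit f D L x"
        using other_limit_if_second_function[OF D L(1) lim, of g x] g assms(5) by blast
      then have "L \<in> E" using E(2) by blast
      moreover have "L \<in> C" using L by (simp add: C_def)
      ultimately show ?thesis by blast
    qed
  next
    fix L assume "L \<in> E \<inter> C \<union> (\<Union>d\<in>DD. S d)"
    then consider "L \<in> E" "L \<in> C" | d where "d \<in> DD" "L \<in> S d" by blast
    then show "L \<in> conv_set f"
    proof cases
      case 1
      then have "\<not> N L x" for x using E(3) by blast
      then show ?thesis using 1(2) by (auto simp: conv_iff C_def N_def)
    next
      case 2
      have "(\<lambda>k. f (nth_elem L k) y) \<longlonglongrightarrow> d y" for y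
      proof (rule tendsto_if_determined[OF K fK, where D = "D \<union> Q d"])
        show "h = d" if "h \<in> K" "\<And>x. x \<in> D \<union> Q d \<Longrightarrow> h x = d x" for h
          using Q(2)[OF 2(1) that(1)] that(2) by blast
        show "(\<lambda>k. f (nth_elem L k) z) \<longlonglongrightarrow> d z" if "z \<in> D \<union> Q d" for z
        proof -
          have "convergent (subval f L z)" "lim (subval f L z) = d z"
            using 2(2) that unfolding S_def by blast+
          then show ?thesis unfolding eq by (simp add: convergent_LIMSEQ_iff)
        qed
      qed
      then show ?thesis using 2(2) by (auto simp: conv_iff S_def eq convergent_def)
    qed
  qed
  moreover have "E \<inter> C \<union> (\<Union>d\<in>DD. S d) \<in> sets borel"
    using E(1) C_borel S_borel DD(1) by (intro sets.Un sets.Int sets.countable_UN') auto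
  ultimately have "conv_set f \<in> sets borel" by simp
  moreover have "conv_set f \<subseteq> inf_subsets" by (auto simp: conv_set_def)
  ultimately show ?thesis by (auto simp: sets_restrict_space intro!: image_eqI[of _ _ "conv_set f"])
qed

end
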